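(* Let $N\ge 1$ be an integer, $m>0$, $\gamma>0$, and suppose that the coupling strength $\kappa$ and the initial configuration $(\theta_i^{in},\omega_i^{in})_{i=1}^N\in\mathbb{R}^N\times\mathbb{R}^N$ satisfy $$\kappa>0\quad\text{and}\quad \frac{m}{N}\sum_{i=1}^N|\omega_i^{in}|^2\le \kappa\, R_p(\Theta^{in})^2 .$$ Let $\Theta=(\theta_1,\dots,\theta_N)$, with $\omega_i=\dot\theta_i$ and $\Omega=(\omega_1,\dots,\omega_N)$, be the solution of $$m\ddot\theta_i=-\gamma\dot\theta_i+\frac{\kappa}{N}\sum_{j=1}^N\sin(\theta_j-\theta_i),\quad t>0,\quad i=1,\dots,N,$$ with initial data $(\theta_i,\dot\theta_i)(0)=(\theta_i^{in},\omega_i^{in})$. Then the following assertions hold. (1) Complete synchronization emerges asymptotically: $\lim_{t\to\infty}|\omega_i(t)-\omega_j(t)|=0$ for all $1\le i,j\le N$. (2) If $R_p(\Theta^{in})=0$, then the system stays as a phase-locked state and $R_p(\Theta(t))=0$ for all $t\ge0$. (3) If $R_p(\Theta^{in})>0$, then there exist a constant $R_*>0$ and an $(N-k,k)$-type phase vector $\Theta^\infty\in\mathbb{R}^N$ such that $$\inf_{0\le t<\infty}R_p(\Theta(t))\ge R_*\quad\text{and}\quad \lim_{t\to\infty}\|\Theta(t)-\Theta^\infty\|=0.$$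
   Context: The system is regarded as a dynamical system on $\mathbb{R}^N\times\mathbb{R}^N$ (phases are real numbers, not reduced mod $2\pi$). For $\Theta\in\mathbb{R}^N$, the order parameter is $R_p(\Theta)=\left|\frac1N\sum_{j=1}^N e^{\mathrm{i}\theta_j}\right|$. $\|\cdot\|$ is the Euclidean norm on $\mathbb{R}^N$. A solution $\Theta(t)$ is a phase-locked state if $|\theta_i(t)-\theta_j(t)|=|\theta_i^{in}-\theta_j^{in}|$ for all $1\le i,j\le N$ and all $t\ge0$. A vector $\Theta^\infty\in\mathbb{R}^N$ is of $(N-k,k)$-type if there exist $\varphi^\infty\in\mathbb{R}$ and $I\subseteq\{1,\dots,N\}$ with $|I|=k>N/2$ such that $\theta_i^\infty=\varphi^\infty$ mod $2\pi$ for $i\in I$ and $\theta_i^\infty=\varphi^\infty+\pi$ mod $2\pi$ for $i\notin I$. *)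

theory Defs
  imports "HOL-Analysis.Analysis" "HOL-Library.Real_Mod"
begin

text \<open>
  The oscillators are indexed by a finite type \<open>'n\<close>, so the number of oscillators is
  \<open>N = CARD('n) \<ge> 1\<close>. Phases are real numbers, not reduced modulo \<open>2\<pi>\<close>.
\<close>

definition order_parameter :: "real ^ 'n \<Rightarrow> real" where
  "order_parameter \<theta> =
     cmod (1 / of_nat CARD('n) * (\<Sum>j\<in>UNIV. exp (\<i> * complex_of_real (\<theta> $ j))))"

text \<open>
  A classical solution on \<open>[0,\<infinity>)\<close>, given by the phases \<open>\<theta>\<close> and the frequencies \<open>\<omega>\<close>:
  \<open>\<theta>\<close> is continuously differentiable up to \<open>t = 0\<close> (with the one-sided derivative there), so that
  the initial velocity makes sense, and the second-order equation is required for \<open>t > 0\<close>.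
\<close>

definition inertial_kuramoto_solution ::
  "real \<Rightarrow> real \<Rightarrow> real \<Rightarrow> real ^ 'n \<Rightarrow> real ^ 'n \<Rightarrow>
     (real \<Rightarrow> real ^ 'n) \<Rightarrow> (real \<Rightarrow> real ^ 'n) \<Rightarrow> bool" where
  "inertial_kuramoto_solution m \<gamma> \<kappa> \<theta>in \<omega>in \<theta> \<omega> \<longleftrightarrow>
     \<theta> 0 = \<theta>in \<and> \<omega> 0 = \<omega>in \<and>
     (\<forall>t\<ge>0. (\<theta> has_vector_derivative \<omega> t) (at t within {0..})) \<and>
     continuous_on {0..} \<omega> \<and>
     (\<forall>t>0. \<forall>i. \<exists>a. ((\<lambda>s. \<omega> s $ i) has_real_derivative a) (at t) \<and>
        m * a = - \<gamma> * \<omega> t $ i +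
          \<kappa> / real CARD('n) * (\<Sum>j\<in>UNIV. sin (\<theta> t $ j - \<theta> t $ i)))"

definition phase_locked :: "(real \<Rightarrow> real ^ 'n) \<Rightarrow> bool" where
  "phase_locked \<theta> \<longleftrightarrow>
     (\<forall>i j. \<forall>t\<ge>0. \<bar>\<theta> t $ i - \<theta> t $ j\<bar> = \<bar>\<theta> 0 $ i - \<theta> 0 $ j\<bar>)"

text \<open>The \<open>(N - k, k)\<close>-type phase vectors, with the majority cluster \<open>I\<close> of size \<open>k\<close>.\<close>

definition bipolar_type :: "nat \<Rightarrow> real ^ 'n \<Rightarrow> bool" where
  "bipolar_type k \<theta> \<longleftrightarrow>
     (\<exists>\<phi>. \<exists>I :: 'n set. card I = k \<and> real k > real CARD('n) / 2 \<and>
        (\<forall>i\<in>I. [\<theta> $ i = \<phi>] (rmod (2 * pi))) \<and>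
        (\<forall>i. i \<notin> I \<longrightarrow> [\<theta> $ i = \<phi> + pi] (rmod (2 * pi))))"

end

theory Submission
  imports Defs
begin

text \<open>
  Write \<open>z = X + \<i> Y\<close> for the mean of the points \<open>exp (\<i> \<theta>\<^sub>j)\<close>, so that \<open>R\<^sub>p = \<bar>z\<bar>\<close>. The coupling
  term of oscillator \<open>i\<close> depends on the other oscillators only through \<open>z\<close>: it is \<open>\<kappa>\<close> times the
  pull \<open>g\<^sub>i = Y cos \<theta>\<^sub>i - X sin \<theta>\<^sub>i\<close>. The system is therefore a damped gradient system with energy
  \<open>E = m/2 \<Sum> \<omega>\<^sub>i\<^sup>2 - \<kappa>N/2 R\<^sub>p\<^sup>2\<close>, for which \<open>E' = - \<gamma> \<Sum> \<omega>\<^sub>i\<^sup>2\<close>. The hypothesis on the initial data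
  says exactly that \<open>E 0 \<le> 0\<close>, and hence \<open>m \<Sum> \<omega>\<^sub>i\<^sup>2 \<le> \<kappa> N R\<^sub>p\<^sup>2\<close> at all times
  (\<open>speed_le_order\<close>). Three consequences carry the proof.

  First, \<open>\<bar>(R\<^sub>p\<^sup>2)'\<bar> \<le> (1 + \<kappa>/m) R\<^sub>p\<^sup>2\<close>, so by a two-sided Gronwall estimate \<open>R\<^sub>p\<close> vanishes
  always or never. If it vanishes, so do all frequencies, and the phases are frozen. If it does
  not, then \<open>E 1 < 0\<close> (\<open>energy_1_neg\<close>), and from time \<open>1\<close> on this negative energy
  keeps \<open>R\<^sub>p\<close> away from \<open>0\<close> (\<open>order_bounded_below\<close>).

  Secondly, \<open>E\<close> decreases and is bounded below, so it converges; its second derivative is bounded,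
  so \<open>E'\<close> tends to \<open>0\<close> (\<open>derivative_tendsto_0\<close>), that is \<open>\<omega>\<^sub>i \<longlonglongrightarrow> 0\<close>. The same lemma
  applied to \<open>\<omega>\<^sub>i\<close> gives \<open>g\<^sub>i \<longlonglongrightarrow> 0\<close>.

  Thirdly, \<open>z\<close> being bounded away from \<open>0\<close>, the pulls can only vanish asymptotically if all
  \<open>exp (\<i> \<theta>\<^sub>i)\<close> become parallel to \<open>z\<close>, so \<open>sin (\<theta>\<^sub>i - \<theta>\<^sub>j) \<longlonglongrightarrow> 0\<close>. Zeros of the sine are isolated,
  hence every phase difference converges to some multiple of \<open>\<pi>\<close>
  (\<open>tendsto_multiple_pi_if_sin_tendsto_0\<close>). The pulls add up to zero, so that \<open>m \<Sum> \<omega>\<^sub>i + \<gamma> \<Sum> \<theta>\<^sub>i\<close>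
  is conserved and \<open>\<Sum> \<theta>\<^sub>i\<close> converges too. The differences and the sum determine the
  phases, so every phase converges. The limit has all differences in \<open>\<pi>\<int>\<close> and a nonzero
  order parameter, which makes one of the two antipodal clusters a strict majority
  (\<open>bipolar_type_if_order_pos\<close>).
\<close>

section \<open>Calculus on the half-line\<close>

text \<open>
  Barbalat's lemma in the form in which it is needed: if \<open>f'\<close> were of size \<open>\<epsilon>\<close> at late times, then
  the bound on \<open>f''\<close> would keep it of that order on an interval of fixed length, and \<open>f\<close> could
  not settle.
\<close>

lemma derivative_tendsto_0:
  fixes f f' f'' :: "real \<Rightarrow> real"
  assumes f: "\<And>t. t > 0 \<Longrightarrow> (f has_real_derivative f' t) (at t)"
    and f': "\<And>t. t > 0 \<Longrightarrow> (f' has_real_derivative f'' t) (at t)"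
    and bound: "\<And>t. t > 0 \<Longrightarrow> \<bar>f'' t\<bar> \<le> B"
    and lim: "(f \<longlongrightarrow> l) at_top"
  shows "(f' \<longlongrightarrow> 0) at_top"
proof (rule tendstoI)
  fix e :: real assume "e > 0"
  define K where "K = \<bar>B\<bar> + 1"
  have "K > 0" by (simp add: K_def)
  \<comment> \<open>Over a step of this length \<open>f'\<close> changes by at most \<open>e / 2\<close>.\<close>
  define h where "h = e / (2 * K)"
  have "h > 0" using \<open>e > 0\<close> \<open>K > 0\<close> by (simp add: h_def)
  have "((\<lambda>t. f (t + h)) \<longlongrightarrow> l) at_top"
    using lim by (rule filterlim_compose) (simp add: filterlim_tendsto_add_at_top[OF tendsto_const filterlim_ident] add.commute[of _ h])
  then have "((\<lambda>t. (f (t + h) - f t) / h) \<longlongrightarrow> (l - l) / h) at_top"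
    using lim \<open>h > 0\<close> by (intro tendsto_intros) auto
  then have "((\<lambda>t. (f (t + h) - f t) / h) \<longlongrightarrow> 0) at_top" by simp
  then have "\<forall>\<^sub>F t in at_top. dist ((f (t + h) - f t) / h) 0 < e / 2"
    using \<open>e > 0\<close> by (intro tendstoD) auto
  then show "\<forall>\<^sub>F t in at_top. dist (f' t) 0 < e"
    using eventually_gt_at_top[of 0]
  proof eventually_elim
    case (elim t)
    obtain z where z: "t < z" "z < t + h" "f (t + h) - f t = (t + h - t) * f' z"
      using MVT2[of t "t + h" f f'] \<open>h > 0\<close> elim f by auto
    obtain w where w: "t < w" "w < z" "f' z - f' t = (z - t) * f'' w"
      using MVT2[of t z f' f''] elim f' z by auto
    have "\<bar>f' z - f' t\<bar> = (z - t) * \<bar>f'' w\<bar>"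
      using w z by (simp add: abs_mult)
    also have "\<dots> \<le> h * K"
      using z bound[of w] w elim by (intro mult_mono) (auto simp: K_def)
    also have "\<dots> = e / 2" using \<open>K > 0\<close> by (simp add: h_def)
    finally have "\<bar>f' z - f' t\<bar> \<le> e / 2" .
    moreover have "\<bar>f' z\<bar> < e / 2" using elim z \<open>h > 0\<close> by simp
    ultimately show ?case unfolding dist_real_def by linarith
  qed
qed

lemma gronwall_two_sided:
  fixes f f' :: "real \<Rightarrow> real"
  assumes cont: "continuous_on {0..} f"
    and deriv: "\<And>t. t > 0 \<Longrightarrow> (f has_real_derivative f' t) (at t)"
    and bound: "\<And>t. t > 0 \<Longrightarrow> \<bar>f' t\<bar> \<le> C * f t"
    and "t \<ge> 0"
  shows "f 0 * exp (- C * t) \<le> f t" and "f t \<le> f 0 * exp (C * t)"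
proof -
  have c: "continuous_on {0..t} f"
    using cont by (rule continuous_on_subset) auto
  have "exp (C * 0) * f 0 \<le> exp (C * t) * f t"
  proof (rule DERIV_nonneg_imp_increasing_open[OF \<open>t \<ge> 0\<close>])
    fix x :: real assume "0 < x" "x < t"
    then have "((\<lambda>x. exp (C * x) * f x) has_real_derivative exp (C * x) * (C * f x + f' x)) (at x)"
      by (auto intro!: derivative_eq_intros deriv simp: algebra_simps)
    moreover have "0 \<le> C * f x + f' x" using bound[OF \<open>0 < x\<close>] by linarith
    ultimately show "\<exists>y. ((\<lambda>x. exp (C * x) * f x) has_real_derivative y) (at x) \<and> 0 \<le> y" by force
  qed (intro continuous_intros c)
  then show "f 0 * exp (- C * t) \<le> f t"
    by (simp add: exp_minus field_simps)
  have "exp (- C * t) * f t \<le> exp (- C * 0) * f 0"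
  proof (rule DERIV_nonpos_imp_decreasing_open[OF \<open>t \<ge> 0\<close>])
    fix x :: real assume "0 < x" "x < t"
    then have "((\<lambda>x. exp (- C * x) * f x) has_real_derivative exp (- C * x) * (f' x - C * f x)) (at x)"
      by (auto intro!: derivative_eq_intros deriv simp: algebra_simps)
    moreover have "f' x - C * f x \<le> 0" using bound[OF \<open>0 < x\<close>] by linarith
    ultimately show "\<exists>y. ((\<lambda>x. exp (- C * x) * f x) has_real_derivative y) (at x) \<and> y \<le> 0"
      by (meson exp_ge_zero mult_nonneg_nonpos)
  qed (intro continuous_intros c)
  then show "f t \<le> f 0 * exp (C * t)"
    by (simp add: exp_minus field_simps)
qed

lemma antimono_bounded_below_tendsto:
  fixes f :: "real \<Rightarrow> real"
  assumes mono: "\<And>s t. 0 \<le> s \<Longrightarrow> s \<le> t \<Longrightarrow> f t \<le> f s"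
    and bound: "\<And>t. t \<ge> 0 \<Longrightarrow> b \<le> f t"
  shows "\<exists>l. (f \<longlongrightarrow> l) at_top"
proof (intro exI decreasing_tendsto)
  have bdd: "bdd_below (f ` {0..})" using bound by (auto intro!: bdd_belowI2)
  show "\<forall>\<^sub>F t in at_top. (INF t\<in>{0..}. f t) \<le> f t"
    using eventually_ge_at_top[of 0] by eventually_elim (auto intro!: cINF_lower bdd)
  fix x assume "(INF t\<in>{0..}. f t) < x"
  then obtain s where "s \<ge> 0" "f s < x"
    using cINF_less_iff[OF _ bdd, of x] by auto
  then show "\<forall>\<^sub>F t in at_top. f t < x"
    using le_less_trans[OF mono[OF \<open>s \<ge> 0\<close>]]
    by (intro eventually_mono[OF eventually_ge_at_top[of s]]) blast
qed

text \<open>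
  Once \<open>\<bar>sin g\<bar> < 1\<close>, a continuous \<open>g\<close> can no longer cross an odd multiple of \<open>\<pi>/2\<close>; it stays in
  one branch of the sine and the arcsine recovers it from its sine.
\<close>

lemma tendsto_multiple_pi_if_sin_tendsto_0:
  fixes g :: "real \<Rightarrow> real"
  assumes cont: "continuous_on {0..} g"
    and sin: "((\<lambda>t. sin (g t)) \<longlongrightarrow> 0) at_top"
  shows "\<exists>n::int. (g \<longlongrightarrow> of_int n * pi) at_top"
proof -
  have "\<forall>\<^sub>F t in at_top. dist (sin (g t)) 0 < 1" using sin by (rule tendstoD) simp
  then obtain T0 where T0: "\<And>t. t \<ge> T0 \<Longrightarrow> \<bar>sin (g t)\<bar> < 1"
    by (auto simp: eventually_at_top_linorder)
  define T where "T = max T0 0"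
  have T: "\<bar>sin (g t)\<bar> < 1" if "t \<ge> T" for t using T0 that by (simp add: T_def)
  \<comment> \<open>The branch of the sine in which \<open>g\<close> is caught at time \<open>T\<close> and remains.\<close>
  define n where "n = round (g T / pi)"
  have sin_shift: "sin (x - of_int n * pi) = cos (of_int n * pi) * sin x" for x
    by (simp add: sin_diff sin_integer_2pi sin_zero_iff_int2)
  define u where "u t = g t - of_int n * pi" for t
  have abs_u: "\<bar>u T\<bar> \<le> pi / 2"
  proof -
    have "\<bar>of_int n - g T / pi\<bar> \<le> 1 / 2" unfolding n_def by (rule of_int_round_abs_le)
    then have "\<bar>of_int n - g T / pi\<bar> * pi \<le> 1 / 2 * pi" by (intro mult_right_mono) auto
    also have "\<bar>of_int n - g T / pi\<bar> * pi = \<bar>(of_int n - g T / pi) * pi\<bar>" by (simp add: abs_mult)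
    also have "(of_int n - g T / pi) * pi = - u T" by (simp add: u_def algebra_simps)
    finally show ?thesis by simp
  qed
  have "\<bar>cos (of_int n * pi)\<bar> \<le> 1" by simp
  then have sin_u: "\<bar>sin (u t)\<bar> < 1" if "t \<ge> T" for t
    using T[OF that] mult_right_mono[of "\<bar>cos (of_int n * pi)\<bar>" 1 "\<bar>sin (g t)\<bar>"]
    unfolding u_def sin_shift abs_mult by simp
  have cu: "continuous_on {T..} u"
    unfolding u_def by (intro continuous_intros continuous_on_subset[OF cont]) (auto simp: T_def)
  have ne: "\<bar>u t\<bar> \<noteq> pi / 2" if "t \<ge> T" for t
  proof
    assume "\<bar>u t\<bar> = pi / 2"
    then have "u t = pi / 2 \<or> u t = - (pi / 2)" by linarith
    then show False using sin_u[OF that] by (elim disjE) simp_all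
  qed
  have u: "\<bar>u t\<bar> < pi / 2" if "t \<ge> T" for t
  proof (rule ccontr)
    assume "\<not> ?thesis"
    then have "\<exists>s\<ge>T. s \<le> t \<and> \<bar>u s\<bar> = pi / 2"
      using abs_u that
      by (intro IVT'[of "\<lambda>t. \<bar>u t\<bar>"] continuous_intros continuous_on_subset[OF cu]) auto
    then show False using ne by auto
  qed
  have "((\<lambda>t. arcsin (sin (u t))) \<longlongrightarrow> arcsin (cos (of_int n * pi) * 0)) at_top"
    unfolding u_def sin_shift
  proof (rule continuous_on_tendsto_compose[OF continuous_on_arcsin'])
    show "((\<lambda>t. cos (of_int n * pi) * sin (g t)) \<longlongrightarrow> cos (of_int n * pi) * 0) at_top"
      by (intro tendsto_intros sin)
  qed (auto simp flip: sin_shift)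
  then have "((\<lambda>t. arcsin (sin (u t))) \<longlongrightarrow> 0) at_top" by simp
  moreover have "\<forall>\<^sub>F t in at_top. arcsin (sin (u t)) = u t"
    using eventually_ge_at_top[of T]
  proof eventually_elim
    case (elim t)
    then show ?case using u[OF elim] by (intro arcsin_sin) auto
  qed
  ultimately have "(u \<longlongrightarrow> 0) at_top" by (rule Lim_transform_eventually)
  then have "((\<lambda>t. u t + of_int n * pi) \<longlongrightarrow> 0 + of_int n * pi) at_top" by (intro tendsto_intros)
  then show ?thesis by (auto simp: u_def)
qed

section \<open>The mean field\<close>

text \<open>The real and imaginary part of the complex order parameter.\<close>

definition mean_cos :: "real ^ 'n \<Rightarrow> real" where
  "mean_cos x = (\<Sum>j\<in>UNIV. cos (x $ j)) / real CARD('n)"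

definition mean_sin :: "real ^ 'n \<Rightarrow> real" where
  "mean_sin x = (\<Sum>j\<in>UNIV. sin (x $ j)) / real CARD('n)"

definition pull :: "real ^ 'n \<Rightarrow> 'n \<Rightarrow> real" where
  "pull x i = mean_sin x * cos (x $ i) - mean_cos x * sin (x $ i)"

lemma order_parameter_nonneg: "0 \<le> order_parameter x"
  by (simp add: order_parameter_def)

lemma order_parameter_sq: "(order_parameter (x :: real ^ 'n))\<^sup>2 = (mean_cos x)\<^sup>2 + (mean_sin x)\<^sup>2"
proof -
  have "1 / of_nat CARD('n) * (\<Sum>j\<in>UNIV. exp (\<i> * complex_of_real (x $ j)))
      = Complex (mean_cos x) (mean_sin x)"
    by (auto simp: complex_eq_iff mean_cos_def mean_sin_def Re_exp Im_exp)
  then show ?thesis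
    by (simp only: order_parameter_def cmod_power2 complex.sel)
qed

lemma order_parameter_le_1: "order_parameter (x :: real ^ 'n) \<le> 1"
proof -
  have "cmod (\<Sum>j\<in>UNIV. exp (\<i> * complex_of_real (x $ j))) \<le> (\<Sum>j\<in>(UNIV::'n set). 1)"
    by (rule sum_norm_le) simp
  then show ?thesis by (simp add: order_parameter_def norm_mult norm_divide field_simps)
qed

lemma order_parameter_sq_le_1: "(order_parameter x)\<^sup>2 \<le> 1"
  by (simp add: order_parameter_nonneg order_parameter_le_1 power_le_one)

lemma coupling_eq_pull:
  "(\<Sum>j\<in>UNIV. sin (x $ j - x $ i)) / real CARD('n) = pull (x :: real ^ 'n) i"
  by (simp add: pull_def mean_cos_def mean_sin_def sin_diff sum_subtractf diff_divide_distrib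
      flip: sum_distrib_right)

lemma sum_pull: "(\<Sum>i\<in>UNIV. pull (x :: real ^ 'n) i) = 0"
proof -
  have "(\<Sum>i\<in>UNIV. pull x i) =
      mean_sin x * (\<Sum>i\<in>UNIV. cos (x $ i)) - mean_cos x * (\<Sum>i\<in>UNIV. sin (x $ i))"
    by (simp add: pull_def sum_subtractf sum_distrib_left)
  then show ?thesis by (simp add: mean_cos_def mean_sin_def)
qed

lemma pull_sq_le: "(pull x i)\<^sup>2 \<le> (order_parameter x)\<^sup>2"
proof -
  have "(pull x i)\<^sup>2 + (mean_cos x * cos (x $ i) + mean_sin x * sin (x $ i))\<^sup>2
      = ((mean_cos x)\<^sup>2 + (mean_sin x)\<^sup>2) * ((sin (x $ i))\<^sup>2 + (cos (x $ i))\<^sup>2)"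
    unfolding pull_def by algebra
  then show ?thesis
    using zero_le_power2[of "mean_cos x * cos (x $ i) + mean_sin x * sin (x $ i)"]
    unfolding order_parameter_sq sin_cos_squared_add mult_1_right by linarith
qed

lemma abs_pull_le_1: "\<bar>pull x i\<bar> \<le> 1"
  using order_trans[OF pull_sq_le order_parameter_sq_le_1] by (simp only: abs_square_le_1)

lemma abs_mean_cos_le_1: "\<bar>mean_cos x\<bar> \<le> 1"
  using order_parameter_sq_le_1[of x] zero_le_power2[of "mean_sin x"]
  unfolding order_parameter_sq abs_square_le_1[symmetric] by linarith

lemma abs_mean_sin_le_1: "\<bar>mean_sin x\<bar> \<le> 1"
  using order_parameter_sq_le_1[of x] zero_le_power2[of "mean_cos x"]
  unfolding order_parameter_sq abs_square_le_1[symmetric] by linarith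

text \<open>
  With \<open>z = r exp (\<i> \<phi>)\<close>, the pull is \<open>r sin (\<phi> - \<theta>\<^sub>i)\<close>, so this is the addition theorem for
  \<open>(\<phi> - \<theta>\<^sub>j) - (\<phi> - \<theta>\<^sub>i)\<close>, scaled by \<open>r\<^sup>2\<close>: small pulls force the phases to be nearly parallel.
\<close>

lemma order_mult_sin_diff:
  "(order_parameter x)\<^sup>2 * sin (x $ i - x $ j) =
     pull x j * (mean_cos x * cos (x $ i) + mean_sin x * sin (x $ i)) -
     pull x i * (mean_cos x * cos (x $ j) + mean_sin x * sin (x $ j))"
  unfolding order_parameter_sq pull_def sin_diff by algebra

lemma continuous_order_parameter: "continuous_on S order_parameter"
  unfolding order_parameter_def by (intro continuous_intros)

text \<open>
  If all differences are multiples of \<open>\<pi>\<close>, the phases form two antipodal clusters, and a nonzero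
  order parameter excludes that they have equal size; the larger one plays the role of \<open>I\<close>.
\<close>

lemma bipolar_type_if_order_pos:
  fixes x :: "real ^ 'n"
  assumes diff: "\<And>i j. \<exists>n::int. x $ i - x $ j = of_int n * pi"
    and pos: "order_parameter x > 0"
  shows "\<exists>k. bipolar_type k x"
proof -
  fix i0 :: 'n
  define \<phi> where "\<phi> = x $ i0"
  define A where "A = {i. [x $ i = \<phi>] (rmod (2 * pi))}"
  have A: "[x $ i = \<phi>] (rmod (2 * pi))" if "i \<in> A" for i using that by (simp add: A_def)
  have B: "[x $ i = \<phi> + pi] (rmod (2 * pi))" if "i \<notin> A" for i
  proof -
    obtain n :: int where n: "x $ i - x $ i0 = of_int n * pi" using diff by blast
    show ?thesis
    proof (cases "even n")
      case True
      then obtain k where "n = 2 * k" by (elim evenE)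
      then have "x $ i - \<phi> = of_int k * (2 * pi)" using n by (simp add: \<phi>_def)
      then have "i \<in> A" unfolding A_def by (auto simp: rcong_altdef intro!: exI[of _ "-k"])
      then show ?thesis using that by simp
    next
      case False
      then obtain k where "n = 2 * k + 1" by (elim oddE)
      then have "\<phi> + pi = x $ i - of_int k * (2 * pi)"
        using n by (simp add: \<phi>_def algebra_simps)
      then show ?thesis by (auto simp: rcong_altdef intro!: exI[of _ "-k"])
    qed
  qed
  have e1: "exp (\<i> * complex_of_real (x $ i)) = exp (\<i> * complex_of_real \<phi>)" if "i \<in> A" for i
    using cos_rcong[OF A[OF that]] sin_rcong[OF A[OF that]]
    by (simp add: complex_eq_iff Re_exp Im_exp)
  have e2: "exp (\<i> * complex_of_real (x $ i)) = - exp (\<i> * complex_of_real \<phi>)" if "i \<notin> A" for i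
    using cos_rcong[OF B[OF that]] sin_rcong[OF B[OF that]]
    by (simp add: complex_eq_iff Re_exp Im_exp)
  have "card A \<noteq> card (- A)"
  proof
    assume eq: "card A = card (- A)"
    have "(\<Sum>j\<in>UNIV. exp (\<i> * complex_of_real (x $ j)))
        = (\<Sum>j\<in>A. exp (\<i> * complex_of_real (x $ j))) + (\<Sum>j\<in>-A. exp (\<i> * complex_of_real (x $ j)))"
      by (subst sum.union_disjoint[symmetric]) auto
    also have "\<dots> = 0" using e1 e2 eq by simp
    finally show False using pos by (simp add: order_parameter_def)
  qed
  moreover have "card A + card (- A) = CARD('n)"
    by (subst card_Un_disjoint[symmetric]) auto
  ultimately consider "real (card A) > real CARD('n) / 2" | "real (card (- A)) > real CARD('n) / 2"
    by linarith
  then show ?thesis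
  proof cases
    case 1
    then show ?thesis unfolding bipolar_type_def using A B by blast
  next
    case 2
    \<comment> \<open>Now \<open>- A\<close> is the majority and \<open>\<phi> + \<pi>\<close> its phase; \<open>A\<close> sits half a turn further.\<close>
    have "[x $ i = \<phi> + pi + pi] (rmod (2 * pi))" if "i \<in> A" for i
      using rcong_add[OF A[OF that] rcong_mult_of_int_0_left_left[of 1 "2 * pi"]]
      by (simp add: algebra_simps)
    then show ?thesis unfolding bipolar_type_def using B 2
      by (intro exI[of _ "card (- A)"] exI[of _ "\<phi> + pi"] exI[of _ "- A"]) auto
  qed
qed

section \<open>Dynamics with nonpositive initial energy\<close>

text \<open>
  The initial velocities enter only through the sign of the energy \<open>E\<close> at time \<open>0\<close>; the last
  assumption is \<open>E 0 \<le> 0\<close>, multiplied by \<open>2\<close>.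
\<close>

locale kuramoto_nonpos_energy =
  fixes m \<gamma> \<kappa> :: real and \<theta> \<omega> :: "real \<Rightarrow> real ^ 'n"
  assumes m_pos: "m > 0" and \<gamma>_pos: "\<gamma> > 0" and \<kappa>_pos: "\<kappa> > 0"
    and \<theta>_deriv: "\<And>t. t \<ge> 0 \<Longrightarrow> (\<theta> has_vector_derivative \<omega> t) (at t within {0..})"
    and \<omega>_cont: "continuous_on {0..} \<omega>"
    and \<omega>_deriv: "\<And>t i. t > 0 \<Longrightarrow> ((\<lambda>s. \<omega> s $ i) has_real_derivative
          (- \<gamma> * \<omega> t $ i + \<kappa> * pull (\<theta> t) i) / m) (at t)"
    and initial: "m * (\<Sum>i\<in>UNIV. (\<omega> 0 $ i)\<^sup>2) \<le> \<kappa> * real CARD('n) * (order_parameter (\<theta> 0))\<^sup>2"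
begin

definition accel :: "real \<Rightarrow> 'n \<Rightarrow> real" where
  "accel t i = (- \<gamma> * \<omega> t $ i + \<kappa> * pull (\<theta> t) i) / m"

definition speed_sq :: "real \<Rightarrow> real" where
  "speed_sq t = (\<Sum>i\<in>UNIV. (\<omega> t $ i)\<^sup>2)"

definition order_sq :: "real \<Rightarrow> real" where
  "order_sq t = (order_parameter (\<theta> t))\<^sup>2"

definition energy :: "real \<Rightarrow> real" where
  "energy t = m / 2 * speed_sq t - \<kappa> * real CARD('n) / 2 * order_sq t"

lemma speed_sq_nonneg: "0 \<le> speed_sq t"
  by (simp add: speed_sq_def sum_nonneg)

lemma order_sq_nonneg: "0 \<le> order_sq t"
  by (simp add: order_sq_def)

lemma \<theta>_cont: "continuous_on {0..} \<theta>"
  by (rule continuous_on_vector_derivative) (use \<theta>_deriv in auto)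

lemma \<theta>_deriv_at:
  assumes "t > 0"
  shows "((\<lambda>s. \<theta> s $ i) has_real_derivative \<omega> t $ i) (at t)"
proof -
  have "(\<theta> has_vector_derivative \<omega> t) (at t within {0..})" using \<theta>_deriv assms by simp
  moreover have "at t within {0..} = at t" using assms by (intro at_within_interior) simp
  ultimately have "(\<theta> has_vector_derivative \<omega> t) (at t)" by simp
  from bounded_linear.has_vector_derivative[OF bounded_linear_vec_nth this]
  show ?thesis by (simp add: has_real_derivative_iff_has_vector_derivative)
qed

lemma \<omega>_deriv': "t > 0 \<Longrightarrow> ((\<lambda>s. \<omega> s $ i) has_real_derivative accel t i) (at t)"
  unfolding accel_def by (rule \<omega>_deriv)

lemma mass_accel: "m * accel t i = - \<gamma> * \<omega> t $ i + \<kappa> * pull (\<theta> t) i"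
  using m_pos by (simp add: accel_def)

lemma mean_cos_deriv:
  "t > 0 \<Longrightarrow> ((\<lambda>s. mean_cos (\<theta> s)) has_real_derivative
     - (\<Sum>j\<in>UNIV. sin (\<theta> t $ j) * \<omega> t $ j) / real CARD('n)) (at t)"
  unfolding mean_cos_def by (auto intro!: derivative_eq_intros \<theta>_deriv_at simp: sum_negf)

lemma mean_sin_deriv:
  "t > 0 \<Longrightarrow> ((\<lambda>s. mean_sin (\<theta> s)) has_real_derivative
     (\<Sum>j\<in>UNIV. cos (\<theta> t $ j) * \<omega> t $ j) / real CARD('n)) (at t)"
  unfolding mean_sin_def by (auto intro!: derivative_eq_intros \<theta>_deriv_at)

lemma order_sq_deriv:
  assumes "t > 0"
  shows "(order_sq has_real_derivative
    2 / real CARD('n) * (\<Sum>i\<in>UNIV. \<omega> t $ i * pull (\<theta> t) i)) (at t)"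
proof -
  let ?x = "\<theta> t"
  have "(order_sq has_real_derivative
      2 * (mean_cos ?x * (- (\<Sum>j\<in>UNIV. sin (?x $ j) * \<omega> t $ j) / real CARD('n)) +
        mean_sin ?x * ((\<Sum>j\<in>UNIV. cos (?x $ j) * \<omega> t $ j) / real CARD('n)))) (at t)"
    unfolding order_sq_def order_parameter_sq
    by (auto intro!: derivative_eq_intros mean_cos_deriv mean_sin_deriv assms simp: algebra_simps)
  also have "2 * (mean_cos ?x * (- (\<Sum>j\<in>UNIV. sin (?x $ j) * \<omega> t $ j) / real CARD('n)) +
        mean_sin ?x * ((\<Sum>j\<in>UNIV. cos (?x $ j) * \<omega> t $ j) / real CARD('n)))
      = 2 / real CARD('n) * (mean_sin ?x * (\<Sum>j\<in>UNIV. cos (?x $ j) * \<omega> t $ j)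
          - mean_cos ?x * (\<Sum>j\<in>UNIV. sin (?x $ j) * \<omega> t $ j))"
    by (simp add: field_simps)
  also have "mean_sin ?x * (\<Sum>j\<in>UNIV. cos (?x $ j) * \<omega> t $ j)
          - mean_cos ?x * (\<Sum>j\<in>UNIV. sin (?x $ j) * \<omega> t $ j)
      = (\<Sum>i\<in>UNIV. \<omega> t $ i * pull ?x i)"
    unfolding sum_distrib_left sum_subtractf[symmetric] pull_def
    by (intro sum.cong) (simp_all add: algebra_simps)
  finally show ?thesis .
qed

lemma speed_sq_deriv:
  assumes "t > 0"
  shows "(speed_sq has_real_derivative (\<Sum>i\<in>UNIV. 2 * \<omega> t $ i * accel t i)) (at t)"
  unfolding speed_sq_def
  by (auto intro!: derivative_eq_intros \<omega>_deriv' assms sum.cong simp: algebra_simps)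

text \<open>
  The power of the coupling forces is \<open>\<kappa> \<Sum> \<omega>\<^sub>i g\<^sub>i\<close>, which is the growth rate of \<open>\<kappa>N/2 R\<^sub>p\<^sup>2\<close>; only
  friction is left.
\<close>

lemma energy_deriv:
  assumes "t > 0"
  shows "(energy has_real_derivative - \<gamma> * speed_sq t) (at t)"
proof -
  have "(energy has_real_derivative
      m / 2 * (\<Sum>i\<in>UNIV. 2 * \<omega> t $ i * accel t i)
      - \<kappa> * real CARD('n) / 2 * (2 / real CARD('n) * (\<Sum>i\<in>UNIV. \<omega> t $ i * pull (\<theta> t) i))) (at t)"
    unfolding energy_def
    by (intro DERIV_diff DERIV_cmult speed_sq_deriv order_sq_deriv assms)
  also have "m / 2 * (\<Sum>i\<in>UNIV. 2 * \<omega> t $ i * accel t i)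
      = (\<Sum>i\<in>UNIV. \<omega> t $ i * (m * accel t i))"
    unfolding sum_distrib_left by (intro sum.cong) simp_all
  also have "\<kappa> * real CARD('n) / 2 * (2 / real CARD('n) * (\<Sum>i\<in>UNIV. \<omega> t $ i * pull (\<theta> t) i))
      = (\<Sum>i\<in>UNIV. \<omega> t $ i * (\<kappa> * pull (\<theta> t) i))"
    by (simp add: sum_distrib_left algebra_simps)
  also have "(\<Sum>i\<in>UNIV. \<omega> t $ i * (m * accel t i)) - (\<Sum>i\<in>UNIV. \<omega> t $ i * (\<kappa> * pull (\<theta> t) i))
      = - \<gamma> * speed_sq t"
    unfolding sum_subtractf[symmetric] mass_accel speed_sq_def sum_distrib_left
    by (intro sum.cong) (simp_all add: algebra_simps power2_eq_square)
  finally show ?thesis .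
qed

lemma speed_sq_cont: "continuous_on {0..} speed_sq"
  unfolding speed_sq_def by (intro continuous_intros \<omega>_cont)

lemma order_sq_cont: "continuous_on {0..} order_sq"
  unfolding order_sq_def order_parameter_def by (intro continuous_intros \<theta>_cont)

lemma energy_cont: "continuous_on {0..} energy"
  unfolding energy_def by (intro continuous_intros speed_sq_cont order_sq_cont)

lemma energy_antimono:
  assumes "0 \<le> s" "s \<le> t"
  shows "energy t \<le> energy s"
proof (rule DERIV_nonpos_imp_decreasing_open[OF \<open>s \<le> t\<close>])
  fix x assume "s < x" "x < t"
  then have "(energy has_real_derivative - \<gamma> * speed_sq x) (at x)"
    using assms by (intro energy_deriv) simp
  moreover have "- \<gamma> * speed_sq x \<le> 0" using \<gamma>_pos speed_sq_nonneg[of x] by simp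
  ultimately show "\<exists>y. (energy has_real_derivative y) (at x) \<and> y \<le> 0" by blast
qed (use energy_cont assms in \<open>auto intro: continuous_on_subset\<close>)

lemma energy_nonpos: "t \<ge> 0 \<Longrightarrow> energy t \<le> 0"
  using energy_antimono[of 0 t] initial by (simp add: energy_def speed_sq_def order_sq_def)

lemma speed_le_order: "t \<ge> 0 \<Longrightarrow> m * speed_sq t \<le> \<kappa> * real CARD('n) * order_sq t"
  using energy_nonpos[of t] by (simp add: energy_def)

text \<open>
  Here the energy inequality closes the estimate: the growth rate of \<open>R\<^sub>p\<^sup>2\<close> involves the
  frequencies, which are themselves controlled by \<open>R\<^sub>p\<close>.
\<close>

lemma order_sq_deriv_bound:
  assumes "t \<ge> 0"
  shows "\<bar>2 / real CARD('n) * (\<Sum>i\<in>UNIV. \<omega> t $ i * pull (\<theta> t) i)\<bar> \<le> (1 + \<kappa> / m) * order_sq t"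
proof -
  have "\<bar>\<Sum>i\<in>UNIV. \<omega> t $ i * pull (\<theta> t) i\<bar> \<le> (\<Sum>i\<in>UNIV. \<bar>\<omega> t $ i * pull (\<theta> t) i\<bar>)"
    by (rule sum_abs)
  also have "\<dots> \<le> (\<Sum>i\<in>UNIV. ((\<omega> t $ i)\<^sup>2 + order_sq t) / 2)"
  proof (rule sum_mono)
    fix i
    have "0 \<le> (\<bar>\<omega> t $ i\<bar> - \<bar>pull (\<theta> t) i\<bar>)\<^sup>2" by simp
    then have "2 * \<bar>\<omega> t $ i * pull (\<theta> t) i\<bar> \<le> (\<omega> t $ i)\<^sup>2 + (pull (\<theta> t) i)\<^sup>2"
      by (simp add: power2_diff abs_mult)
    also have "(pull (\<theta> t) i)\<^sup>2 \<le> order_sq t" unfolding order_sq_def by (rule pull_sq_le)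
    finally show "\<bar>\<omega> t $ i * pull (\<theta> t) i\<bar> \<le> ((\<omega> t $ i)\<^sup>2 + order_sq t) / 2" by simp
  qed
  also have "\<dots> = (speed_sq t + real CARD('n) * order_sq t) / 2"
    by (simp add: speed_sq_def sum.distrib flip: sum_divide_distrib)
  finally have "2 / real CARD('n) * \<bar>\<Sum>i\<in>UNIV. \<omega> t $ i * pull (\<theta> t) i\<bar>
      \<le> 2 / real CARD('n) * ((speed_sq t + real CARD('n) * order_sq t) / 2)"
    by (intro mult_left_mono) auto
  also have "\<dots> = order_sq t + speed_sq t / real CARD('n)" by (simp add: field_simps)
  also have "speed_sq t / real CARD('n) \<le> \<kappa> / m * order_sq t"
    using speed_le_order[OF assms] m_pos by (simp add: field_simps)
  finally show ?thesis by (simp add: abs_mult algebra_simps)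
qed

lemma order_sq_gronwall:
  assumes "t \<ge> 0"
  shows "order_sq 0 * exp (- (1 + \<kappa> / m) * t) \<le> order_sq t"
    and "order_sq t \<le> order_sq 0 * exp ((1 + \<kappa> / m) * t)"
  using gronwall_two_sided[OF order_sq_cont order_sq_deriv order_sq_deriv_bound assms] by simp_all

subsection \<open>Vanishing order parameter\<close>

lemma order_sq_zero:
  assumes "order_sq 0 = 0" "t \<ge> 0"
  shows "order_sq t = 0"
  using order_sq_gronwall(2)[OF \<open>t \<ge> 0\<close>] assms order_sq_nonneg[of t] by simp

lemma phases_constant:
  assumes "order_sq 0 = 0" "t \<ge> 0"
  shows "\<theta> t = \<theta> 0"
proof -
  have "\<omega> s = 0" if "s \<ge> 0" for s
  proof -
    have "m * speed_sq s \<le> 0"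
      using speed_le_order[OF that] order_sq_zero[OF assms(1) that] by simp
    then have "speed_sq s = 0"
      using m_pos speed_sq_nonneg[of s] by (simp add: mult_le_0_iff)
    then show ?thesis by (simp add: speed_sq_def sum_nonneg_eq_0_iff vec_eq_iff)
  qed
  then have "\<And>s. s \<in> {0..} \<Longrightarrow> (\<theta> has_vector_derivative 0) (at s within {0..})"
    using \<theta>_deriv by fastforce
  then obtain c where "\<And>s. s \<in> {0..} \<Longrightarrow> \<theta> s = c"
    using has_vector_derivative_zero_constant[of "{0..}" \<theta>] by auto
  then show ?thesis using \<open>t \<ge> 0\<close> by simp
qed

subsection \<open>A uniform lower bound for a positive order parameter\<close>

lemma order_sq_pos:
  assumes "order_sq 0 > 0" "t \<ge> 0"
  shows "order_sq t > 0"
  using order_sq_gronwall(1)[OF \<open>t \<ge> 0\<close>] assms(1)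
  by (elim less_le_trans[rotated]) simp

text \<open>
  Otherwise the nonpositive, decreasing energy would be constantly zero on \<open>(0, 1)\<close>. Then nothing is
  dissipated there, so the frequencies vanish, and zero energy leaves nothing for the order parameter.
\<close>

lemma energy_1_neg:
  assumes "order_sq 0 > 0"
  shows "energy 1 < 0"
proof (rule ccontr)
  assume "\<not> energy 1 < 0"
  then have zero: "energy t = 0" if "t \<in> {0<..<1}" for t
    using energy_antimono[of t 1] energy_nonpos[of t] that by simp
  have "(energy has_real_derivative 0) (at (1/2))"
    by (rule has_field_derivative_transform_within_open[of "\<lambda>_. 0" _ _ "{0<..<1}"])
      (use zero in auto)
  then have "- \<gamma> * speed_sq (1/2) = 0"
    using DERIV_unique energy_deriv[of "1/2"] by fastforce
  then have "speed_sq (1/2) = 0" using \<gamma>_pos by simp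
  then have "order_sq (1/2) = 0"
    using zero[of "1/2"] \<kappa>_pos by (simp add: energy_def)
  then show False using order_sq_pos[OF assms, of "1/2"] by simp
qed

lemma order_bounded_below:
  assumes "order_sq 0 > 0"
  shows "\<exists>R>0. \<forall>t\<ge>0. R \<le> order_parameter (\<theta> t)"
proof -
  define C where "C = 1 + \<kappa> / m"
  have "C > 0" using m_pos \<kappa>_pos by (simp add: C_def add_pos_pos)
  \<comment> \<open>Up to time \<open>1\<close> the Gronwall bound holds, afterwards the bound by the energy.\<close>
  define c where "c = min (order_sq 0 * exp (- C)) (- 2 * energy 1 / (\<kappa> * real CARD('n)))"
  have "c > 0"
    using assms energy_1_neg[OF assms] \<kappa>_pos by (simp add: c_def divide_neg_pos)
  have "c \<le> order_sq t" if "t \<ge> 0" for t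
  proof (cases "t \<le> 1")
    case True
    have "order_sq 0 * exp (- C) \<le> order_sq 0 * exp (- C * t)"
      using True \<open>C > 0\<close> assms by simp
    also have "\<dots> \<le> order_sq t"
      using order_sq_gronwall(1)[OF that] by (simp add: C_def)
    finally show ?thesis by (simp add: c_def)
  next
    case False
    then have "energy t \<le> energy 1" by (intro energy_antimono) auto
    moreover have "m / 2 * speed_sq t \<ge> 0" using m_pos speed_sq_nonneg[of t] by simp
    ultimately have "- 2 * energy 1 \<le> \<kappa> * real CARD('n) * order_sq t" unfolding energy_def[of t] by argo
    then have "- 2 * energy 1 / (\<kappa> * real CARD('n)) \<le> order_sq t"
      using \<kappa>_pos by (simp add: field_simps)
    then show ?thesis by (simp add: c_def)
  qed
  then have "\<forall>t\<ge>0. sqrt c \<le> order_parameter (\<theta> t)"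
    by (auto simp: order_sq_def intro!: real_le_lsqrt order_parameter_nonneg)
  then show ?thesis using \<open>c > 0\<close> by (intro exI[of _ "sqrt c"]) auto
qed

subsection \<open>Frequencies and pulls vanish asymptotically\<close>

definition \<omega>_max :: real where
  "\<omega>_max = sqrt (\<kappa> * real CARD('n) / m)"

definition accel_max :: real where
  "accel_max = (\<gamma> * \<omega>_max + \<kappa>) / m"

lemma abs_\<omega>_le:
  assumes "t \<ge> 0"
  shows "\<bar>\<omega> t $ i\<bar> \<le> \<omega>_max"
proof -
  have "(\<omega> t $ i)\<^sup>2 \<le> speed_sq t"
    unfolding speed_sq_def by (rule member_le_sum) auto
  moreover have "m * speed_sq t \<le> \<kappa> * real CARD('n) * 1"
    using speed_le_order[OF assms] \<kappa>_pos order_parameter_sq_le_1[of "\<theta> t"]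
    by (elim order_trans, intro mult_left_mono) (auto simp: order_sq_def)
  then have "speed_sq t \<le> \<kappa> * real CARD('n) / m" using m_pos by (simp add: field_simps)
  ultimately show ?thesis unfolding \<omega>_max_def by (simp add: real_le_rsqrt)
qed

lemma \<omega>_max_nonneg: "0 \<le> \<omega>_max"
  using m_pos \<kappa>_pos by (simp add: \<omega>_max_def)

lemma abs_accel_le:
  assumes "t \<ge> 0"
  shows "\<bar>accel t i\<bar> \<le> accel_max"
proof -
  have "\<bar>- \<gamma> * \<omega> t $ i + \<kappa> * pull (\<theta> t) i\<bar> \<le> \<bar>- \<gamma> * \<omega> t $ i\<bar> + \<bar>\<kappa> * pull (\<theta> t) i\<bar>"
    by (rule abs_triangle_ineq)
  also have "\<dots> \<le> \<gamma> * \<omega>_max + \<kappa> * 1"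
    unfolding abs_mult using \<gamma>_pos \<kappa>_pos abs_\<omega>_le[OF assms, of i] abs_pull_le_1[of "\<theta> t" i]
    by (intro add_mono mult_mono) auto
  finally show ?thesis using m_pos by (simp add: accel_def accel_max_def divide_right_mono)
qed

lemma abs_mean_le:
  assumes "\<And>j. \<bar>c j\<bar> \<le> 1" "t \<ge> 0"
  shows "\<bar>(\<Sum>j\<in>UNIV. c j * \<omega> t $ j) / real CARD('n)\<bar> \<le> \<omega>_max"
proof -
  have "\<bar>\<Sum>j\<in>UNIV. c j * \<omega> t $ j\<bar> \<le> (\<Sum>j\<in>UNIV. \<bar>c j * \<omega> t $ j\<bar>)" by (rule sum_abs)
  also have "\<dots> \<le> (\<Sum>j\<in>(UNIV :: 'n set). 1 * \<omega>_max)"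
    unfolding abs_mult by (intro sum_mono mult_mono assms abs_\<omega>_le) auto
  finally show ?thesis by (simp add: field_simps)
qed

lemma pull_deriv:
  assumes "t > 0"
  shows "\<exists>d. ((\<lambda>s. pull (\<theta> s) i) has_real_derivative d) (at t) \<and> \<bar>d\<bar> \<le> 4 * \<omega>_max"
proof -
  let ?x = "\<theta> t"
  let ?X' = "- (\<Sum>j\<in>UNIV. sin (?x $ j) * \<omega> t $ j) / real CARD('n)"
  let ?Y' = "(\<Sum>j\<in>UNIV. cos (?x $ j) * \<omega> t $ j) / real CARD('n)"
  let ?d = "?Y' * cos (?x $ i) - mean_sin ?x * sin (?x $ i) * \<omega> t $ i
    - ?X' * sin (?x $ i) - mean_cos ?x * cos (?x $ i) * \<omega> t $ i"
  have "((\<lambda>s. pull (\<theta> s) i) has_real_derivative ?d) (at t)"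
    unfolding pull_def
    by (auto intro!: derivative_eq_intros mean_cos_deriv mean_sin_deriv \<theta>_deriv_at assms
        simp: algebra_simps)
  moreover have "\<bar>?d\<bar> \<le> 4 * \<omega>_max"
  proof -
    have "\<bar>?Y'\<bar> \<le> \<omega>_max" using assms by (intro abs_mean_le) auto
    then have a: "\<bar>?Y' * cos (?x $ i)\<bar> \<le> \<omega>_max * 1"
      unfolding abs_mult[of ?Y'] by (rule mult_mono) (auto simp: \<omega>_max_nonneg)
    have "\<bar>?X'\<bar> \<le> \<omega>_max"
      using abs_mean_le[of "\<lambda>j. sin (?x $ j)" t] assms by simp
    then have b: "\<bar>?X' * sin (?x $ i)\<bar> \<le> \<omega>_max * 1"
      unfolding abs_mult[of ?X'] by (rule mult_mono) (auto simp: \<omega>_max_nonneg)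
    have c: "\<bar>mean_sin ?x * sin (?x $ i) * \<omega> t $ i\<bar> \<le> 1 * 1 * \<omega>_max"
      unfolding abs_mult using assms
      by (intro mult_mono abs_mean_sin_le_1 abs_\<omega>_le) auto
    have d: "\<bar>mean_cos ?x * cos (?x $ i) * \<omega> t $ i\<bar> \<le> 1 * 1 * \<omega>_max"
      unfolding abs_mult using assms
      by (intro mult_mono abs_mean_cos_le_1 abs_\<omega>_le) auto
    show ?thesis using a b c d by linarith
  qed
  ultimately show ?thesis by blast
qed

text \<open>By the dissipation law, \<open>- \<gamma> \<Sum> \<omega>\<^sub>i\<^sup>2\<close> is the derivative of the convergent energy.\<close>

lemma speed_sq_tendsto_0: "(speed_sq \<longlongrightarrow> 0) at_top"
proof -
  have "- \<kappa> * real CARD('n) / 2 * 1 \<le> energy t" for t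
  proof -
    have "\<kappa> * real CARD('n) / 2 * order_sq t \<le> \<kappa> * real CARD('n) / 2 * 1"
      using \<kappa>_pos order_parameter_sq_le_1[of "\<theta> t"]
      by (intro mult_left_mono) (auto simp: order_sq_def)
    moreover have "m / 2 * speed_sq t \<ge> 0" using m_pos speed_sq_nonneg[of t] by simp
    ultimately show ?thesis by (simp add: energy_def)
  qed
  from antimono_bounded_below_tendsto[of energy, OF energy_antimono this]
  obtain l where l: "(energy \<longlongrightarrow> l) at_top"
    by blast
  have "((\<lambda>t. - \<gamma> * speed_sq t) \<longlongrightarrow> 0) at_top"
  proof (rule derivative_tendsto_0[OF energy_deriv _ _ l])
    fix t :: real assume "t > 0"
    then show "((\<lambda>t. - \<gamma> * speed_sq t) has_real_derivative
        - \<gamma> * (\<Sum>i\<in>UNIV. 2 * \<omega> t $ i * accel t i)) (at t)"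
      by (intro DERIV_cmult speed_sq_deriv)
    have "\<bar>\<Sum>i\<in>UNIV. 2 * \<omega> t $ i * accel t i\<bar> \<le> (\<Sum>i\<in>UNIV. \<bar>2 * \<omega> t $ i * accel t i\<bar>)"
      by (rule sum_abs)
    also have "\<dots> \<le> (\<Sum>i\<in>(UNIV :: 'n set). 2 * \<omega>_max * accel_max)"
      unfolding abs_mult using \<open>t > 0\<close> \<omega>_max_nonneg
      by (intro sum_mono mult_mono abs_\<omega>_le abs_accel_le) auto
    finally show "\<bar>- \<gamma> * (\<Sum>i\<in>UNIV. 2 * \<omega> t $ i * accel t i)\<bar>
        \<le> \<gamma> * (real CARD('n) * (2 * \<omega>_max * accel_max))"
      using \<gamma>_pos by (simp add: abs_mult)
  qed
  then have "((\<lambda>t. - 1 / \<gamma> * (- \<gamma> * speed_sq t)) \<longlongrightarrow> - 1 / \<gamma> * 0) at_top"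
    by (intro tendsto_intros)
  then show ?thesis using \<gamma>_pos by simp
qed

lemma \<omega>_tendsto_0: "((\<lambda>t. \<omega> t $ i) \<longlongrightarrow> 0) at_top"
proof (rule tendsto_0_le[where K = 1])
  show "((\<lambda>t. sqrt (speed_sq t)) \<longlongrightarrow> 0) at_top"
    using tendsto_real_sqrt[OF speed_sq_tendsto_0] by simp
  have "(\<omega> t $ i)\<^sup>2 \<le> speed_sq t" for t
    unfolding speed_sq_def by (rule member_le_sum) auto
  then show "\<forall>\<^sub>F t in at_top. norm (\<omega> t $ i) \<le> norm (sqrt (speed_sq t)) * 1"
    by (simp add: speed_sq_nonneg real_le_rsqrt)
qed

text \<open>
  The accelerations are derivatives of the convergent frequencies, so they vanish asymptotically;
  with friction gone as well, the equation of motion leaves only the pulls.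
\<close>

lemma pull_tendsto_0: "((\<lambda>t. pull (\<theta> t) i) \<longlongrightarrow> 0) at_top"
proof -
  have "\<forall>t\<in>{0<..}. \<exists>d. ((\<lambda>s. pull (\<theta> s) i) has_real_derivative d) (at t) \<and> \<bar>d\<bar> \<le> 4 * \<omega>_max"
    by (intro ballI pull_deriv) simp
  from bchoice[OF this] obtain d where
    d: "\<And>t. t > 0 \<Longrightarrow> ((\<lambda>s. pull (\<theta> s) i) has_real_derivative d t) (at t)"
      "\<And>t. t > 0 \<Longrightarrow> \<bar>d t\<bar> \<le> 4 * \<omega>_max"
    by auto
  have "((\<lambda>t. accel t i) \<longlongrightarrow> 0) at_top"
  proof (rule derivative_tendsto_0[OF \<omega>_deriv' _ _ \<omega>_tendsto_0])
    fix t :: real assume "t > 0"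
    then show "((\<lambda>t. accel t i) has_real_derivative (- \<gamma> * accel t i + \<kappa> * d t) / m) (at t)"
      unfolding accel_def[abs_def] using m_pos
      by (auto intro!: derivative_eq_intros d \<omega>_deriv' simp: accel_def)
    have "\<bar>- \<gamma> * accel t i + \<kappa> * d t\<bar> \<le> \<bar>- \<gamma> * accel t i\<bar> + \<bar>\<kappa> * d t\<bar>"
      by (rule abs_triangle_ineq)
    also have "\<dots> \<le> \<gamma> * accel_max + \<kappa> * (4 * \<omega>_max)"
      unfolding abs_mult using \<gamma>_pos \<kappa>_pos \<open>t > 0\<close>
      by (intro add_mono mult_mono abs_accel_le d) auto
    finally show "\<bar>(- \<gamma> * accel t i + \<kappa> * d t) / m\<bar> \<le> (\<gamma> * accel_max + \<kappa> * (4 * \<omega>_max)) / m"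
      using m_pos by (simp add: divide_right_mono)
  qed
  then have "((\<lambda>t. (m * accel t i + \<gamma> * \<omega> t $ i) / \<kappa>) \<longlongrightarrow> (m * 0 + \<gamma> * 0) / \<kappa>) at_top"
    using \<kappa>_pos by (intro tendsto_intros \<omega>_tendsto_0) auto
  then show ?thesis using m_pos \<kappa>_pos by (simp add: accel_def)
qed

subsection \<open>Convergence of the phases\<close>

text \<open>
  The coupling is invariant under a common rotation, and differences alone do not see the mean
  phase. Its limit comes from the conserved quantity \<open>m \<Sum> \<omega>\<^sub>i + \<gamma> \<Sum> \<theta>\<^sub>i\<close>.
\<close>

lemma sum_\<theta>_tendsto: "\<exists>l. ((\<lambda>t. \<Sum>i\<in>UNIV. \<theta> t $ i) \<longlongrightarrow> l) at_top"
proof -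
  define c where "c t = m * (\<Sum>i\<in>UNIV. \<omega> t $ i) + \<gamma> * (\<Sum>i\<in>UNIV. \<theta> t $ i)" for t
  have "(c has_real_derivative 0) (at t)" if "t > 0" for t
  proof -
    have "(c has_real_derivative m * (\<Sum>i\<in>UNIV. accel t i) + \<gamma> * (\<Sum>i\<in>UNIV. \<omega> t $ i)) (at t)"
      unfolding c_def by (intro DERIV_add DERIV_cmult DERIV_sum \<omega>_deriv' \<theta>_deriv_at that)
    moreover have "m * (\<Sum>i\<in>UNIV. accel t i) = - \<gamma> * (\<Sum>i\<in>UNIV. \<omega> t $ i)"
      unfolding sum_distrib_left[of m] mass_accel sum.distrib
      using sum_pull[of "\<theta> t"] by (simp flip: sum_distrib_left add: sum_negf)
    ultimately show ?thesis by simp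
  qed
  then have const: "c t = c 1" if "t > 0" for t
    using has_field_derivative_zero_constant[of "{0<..}" c] that
    by (auto simp: has_field_derivative_at_within)
  have eq: "(\<Sum>i\<in>UNIV. \<theta> t $ i) = (c 1 - m * (\<Sum>i\<in>UNIV. \<omega> t $ i)) / \<gamma>" if "t > 0" for t
    unfolding const[OF that, symmetric] using \<gamma>_pos by (simp add: c_def)
  have "((\<lambda>t. (c 1 - m * (\<Sum>i\<in>UNIV. \<omega> t $ i)) / \<gamma>) \<longlongrightarrow> (c 1 - m * (\<Sum>i\<in>(UNIV::'n set). 0)) / \<gamma>) at_top"
    using \<gamma>_pos by (intro tendsto_intros \<omega>_tendsto_0) auto
  moreover have "\<forall>\<^sub>F t in at_top. (c 1 - m * (\<Sum>i\<in>UNIV. \<omega> t $ i)) / \<gamma> = (\<Sum>i\<in>UNIV. \<theta> t $ i)"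
    using eventually_gt_at_top[of 0] by eventually_elim (simp add: eq)
  ultimately show ?thesis by (blast intro: Lim_transform_eventually)
qed

lemma phase_diff_tendsto:
  assumes "order_sq 0 > 0"
  shows "\<exists>n::int. ((\<lambda>t. \<theta> t $ i - \<theta> t $ j) \<longlongrightarrow> of_int n * pi) at_top"
proof (rule tendsto_multiple_pi_if_sin_tendsto_0)
  show "continuous_on {0..} (\<lambda>t. \<theta> t $ i - \<theta> t $ j)"
    by (intro continuous_intros \<theta>_cont)
  obtain R where R: "R > 0" "\<And>t. t \<ge> 0 \<Longrightarrow> R \<le> order_parameter (\<theta> t)"
    using order_bounded_below[OF assms] by blast
  show "((\<lambda>t. sin (\<theta> t $ i - \<theta> t $ j)) \<longlongrightarrow> 0) at_top"
  proof (rule tendsto_0_le[where K = 1])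
    show "((\<lambda>t. 2 / R\<^sup>2 * (\<bar>pull (\<theta> t) j\<bar> + \<bar>pull (\<theta> t) i\<bar>)) \<longlongrightarrow> 0) at_top"
      by (intro tendsto_mult_right_zero tendsto_add_zero tendsto_rabs_zero pull_tendsto_0)
    show "\<forall>\<^sub>F t in at_top. norm (sin (\<theta> t $ i - \<theta> t $ j))
        \<le> norm (2 / R\<^sup>2 * (\<bar>pull (\<theta> t) j\<bar> + \<bar>pull (\<theta> t) i\<bar>)) * 1"
      using eventually_ge_at_top[of 0]
    proof eventually_elim
      case (elim t)
      let ?x = "\<theta> t" and ?s = "sin (\<theta> t $ i - \<theta> t $ j)"
      have radial: "\<bar>mean_cos ?x * cos (?x $ k) + mean_sin ?x * sin (?x $ k)\<bar> \<le> 2" for k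
      proof -
        have "\<bar>mean_cos ?x * cos (?x $ k)\<bar> \<le> 1 * 1" "\<bar>mean_sin ?x * sin (?x $ k)\<bar> \<le> 1 * 1"
          unfolding abs_mult by (intro mult_mono abs_mean_cos_le_1 abs_mean_sin_le_1; simp)+
        then show ?thesis by linarith
      qed
      have "R\<^sup>2 * \<bar>?s\<bar> \<le> (order_parameter ?x)\<^sup>2 * \<bar>?s\<bar>"
        using R elim by (intro mult_right_mono power_mono) auto
      also have "\<dots> = \<bar>(order_parameter ?x)\<^sup>2 * ?s\<bar>" by (simp add: abs_mult)
      also have "\<dots> \<le> \<bar>pull ?x j\<bar> * 2 + \<bar>pull ?x i\<bar> * 2"
        unfolding order_mult_sin_diff
        by (rule order_trans[OF abs_triangle_ineq4], unfold abs_mult)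
          (intro add_mono mult_left_mono radial; simp)
      finally show ?case using R(1) by (simp add: field_simps abs_mult)
    qed
  qed
qed

text \<open>Each phase is the average of its differences to all phases plus the mean phase.\<close>

lemma phases_tendsto:
  assumes "order_sq 0 > 0"
  shows "\<exists>x. (\<theta> \<longlongrightarrow> x) at_top"
proof -
  obtain l where l: "((\<lambda>t. \<Sum>i\<in>UNIV. \<theta> t $ i) \<longlongrightarrow> l) at_top"
    using sum_\<theta>_tendsto by blast
  have "\<exists>y. ((\<lambda>t. \<theta> t $ i) \<longlongrightarrow> y) at_top" for i
  proof -
    obtain n where n: "\<And>j. ((\<lambda>t. \<theta> t $ i - \<theta> t $ j) \<longlongrightarrow> of_int (n j) * pi) at_top"
      using phase_diff_tendsto[OF assms] by metis
    have "((\<lambda>t. ((\<Sum>j\<in>UNIV. \<theta> t $ i - \<theta> t $ j) + (\<Sum>j\<in>UNIV. \<theta> t $ j)) / real CARD('n)) \<longlongrightarrow>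
        ((\<Sum>j\<in>UNIV. of_int (n j) * pi) + l) / real CARD('n)) at_top"
      by (intro tendsto_intros l n) simp
    moreover have "((\<Sum>j\<in>UNIV. \<theta> t $ i - \<theta> t $ j) + (\<Sum>j\<in>UNIV. \<theta> t $ j)) / real CARD('n) = \<theta> t $ i" for t
      by (simp add: sum_subtractf)
    ultimately show ?thesis by auto
  qed
  then obtain y where "\<And>i. ((\<lambda>t. \<theta> t $ i) \<longlongrightarrow> y i) at_top" by metis
  then have "(\<theta> \<longlongrightarrow> (\<chi> i. y i)) at_top" by (intro vec_tendstoI) simp
  then show ?thesis by blast
qed

lemma bipolar_limit:
  assumes "order_sq 0 > 0"
  shows "\<exists>R>0. \<exists>k x. bipolar_type k x \<and> (\<forall>t\<ge>0. R \<le> order_parameter (\<theta> t)) \<and> (\<theta> \<longlongrightarrow> x) at_top"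
proof -
  obtain R where R: "R > 0" "\<And>t. t \<ge> 0 \<Longrightarrow> R \<le> order_parameter (\<theta> t)"
    using order_bounded_below[OF assms] by blast
  obtain x where x: "(\<theta> \<longlongrightarrow> x) at_top" using phases_tendsto[OF assms] by blast
  have "\<exists>n::int. x $ i - x $ j = of_int n * pi" for i j
  proof -
    obtain n :: int where "((\<lambda>t. \<theta> t $ i - \<theta> t $ j) \<longlongrightarrow> of_int n * pi) at_top"
      using phase_diff_tendsto[OF assms] by blast
    moreover have "((\<lambda>t. \<theta> t $ i - \<theta> t $ j) \<longlongrightarrow> x $ i - x $ j) at_top"
      by (intro tendsto_intros x)
    ultimately show ?thesis using tendsto_unique[OF trivial_limit_at_top_linorder] by blast
  qed
  moreover have "order_parameter x > 0"
  proof -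
    have "((\<lambda>t. order_parameter (\<theta> t)) \<longlongrightarrow> order_parameter x) at_top"
      by (rule continuous_on_tendsto_compose[OF continuous_order_parameter[of UNIV] x]) auto
    then have "R \<le> order_parameter x"
      by (rule tendsto_lowerbound)
        (use R in \<open>auto intro: eventually_mono[OF eventually_ge_at_top[of 0]]\<close>)
    then show ?thesis using \<open>R > 0\<close> by simp
  qed
  ultimately show ?thesis using bipolar_type_if_order_pos[of x] R x by blast
qed

end

section \<open>Emergence of complete synchronization\<close>

theorem theorem3p4:
  fixes m \<gamma> \<kappa> :: real
    and \<theta>in \<omega>in :: "real ^ 'n"
    and \<theta> \<omega> :: "real \<Rightarrow> real ^ 'n"
  assumes "m > 0" and "\<gamma> > 0" and "\<kappa> > 0"
    and "m / real CARD('n) * (\<Sum>i\<in>UNIV. \<bar>\<omega>in $ i\<bar>\<^sup>2) \<le> \<kappa> * (order_parameter \<theta>in)\<^sup>2"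
    and "inertial_kuramoto_solution m \<gamma> \<kappa> \<theta>in \<omega>in \<theta> \<omega>"
  shows "(\<forall>i j. ((\<lambda>t. \<bar>\<omega> t $ i - \<omega> t $ j\<bar>) \<longlongrightarrow> 0) at_top) \<and>
    (order_parameter \<theta>in = 0 \<longrightarrow>
       phase_locked \<theta> \<and> (\<forall>t\<ge>0. order_parameter (\<theta> t) = 0)) \<and>
    (order_parameter \<theta>in > 0 \<longrightarrow>
       (\<exists>R>0. \<exists>k. \<exists>\<theta>inf :: real ^ 'n.
          bipolar_type k \<theta>inf \<and>
          (INF t\<in>{0..}. order_parameter (\<theta> t)) \<ge> R \<and>
          ((\<lambda>t. norm (\<theta> t - \<theta>inf)) \<longlongrightarrow> 0) at_top))"
proof -
  have start: "\<theta> 0 = \<theta>in" "\<omega> 0 = \<omega>in"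
    using assms(5) by (auto simp: inertial_kuramoto_solution_def)
  interpret kuramoto_nonpos_energy m \<gamma> \<kappa> \<theta> \<omega>
  proof
    fix t :: real and i :: 'n assume "t > 0"
    then obtain a where a: "((\<lambda>s. \<omega> s $ i) has_real_derivative a) (at t)"
      and "m * a = - \<gamma> * \<omega> t $ i +
          \<kappa> / real CARD('n) * (\<Sum>j\<in>UNIV. sin (\<theta> t $ j - \<theta> t $ i))"
      using assms(5) unfolding inertial_kuramoto_solution_def by blast
    then have "m * a = - \<gamma> * \<omega> t $ i + \<kappa> * pull (\<theta> t) i"
      by (simp flip: coupling_eq_pull)
    then have "a = (- \<gamma> * \<omega> t $ i + \<kappa> * pull (\<theta> t) i) / m"
      using \<open>m > 0\<close> by (simp add: field_simps)
    then show "((\<lambda>s. \<omega> s $ i) has_real_derivative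
        (- \<gamma> * \<omega> t $ i + \<kappa> * pull (\<theta> t) i) / m) (at t)"
      using a by simp
  next
    show "m * (\<Sum>i\<in>UNIV. (\<omega> 0 $ i)\<^sup>2) \<le> \<kappa> * real CARD('n) * (order_parameter (\<theta> 0))\<^sup>2"
      using assms(4) by (simp add: start field_simps)
  qed (use assms in \<open>auto simp: inertial_kuramoto_solution_def\<close>)
  have "((\<lambda>t. \<bar>\<omega> t $ i - \<omega> t $ j\<bar>) \<longlongrightarrow> 0) at_top" for i j
    using tendsto_rabs[OF tendsto_diff[OF \<omega>_tendsto_0[of i] \<omega>_tendsto_0[of j]]] by simp
  moreover have "phase_locked \<theta> \<and> (\<forall>t\<ge>0. order_parameter (\<theta> t) = 0)"
    if "order_parameter \<theta>in = 0"
  proof -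
    have "\<theta> t = \<theta> 0" if "t \<ge> 0" for t
      using phases_constant[OF _ that] \<open>order_parameter \<theta>in = 0\<close>
      by (simp add: order_sq_def start)
    then show ?thesis using that by (auto simp: phase_locked_def start)
  qed
  moreover have "\<exists>R>0. \<exists>k. \<exists>\<theta>inf :: real ^ 'n.
      bipolar_type k \<theta>inf \<and>
      (INF t\<in>{0..}. order_parameter (\<theta> t)) \<ge> R \<and>
      ((\<lambda>t. norm (\<theta> t - \<theta>inf)) \<longlongrightarrow> 0) at_top"
    if "order_parameter \<theta>in > 0"
  proof -
    have "order_sq 0 > 0" using that by (simp add: order_sq_def start)
    from bipolar_limit[OF this] obtain R k x where
      x: "R > 0" "bipolar_type k x" "\<And>t. t \<ge> 0 \<Longrightarrow> R \<le> order_parameter (\<theta> t)"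
        "(\<theta> \<longlongrightarrow> x) at_top"
      by blast
    have "(INF t\<in>{0..}. order_parameter (\<theta> t)) \<ge> R"
      using x(3) by (intro cINF_greatest) auto
    moreover have "((\<lambda>t. norm (\<theta> t - x)) \<longlongrightarrow> 0) at_top"
      using x(4) by (intro tendsto_norm_zero LIM_zero)
    ultimately show ?thesis using x by blast
  qed
  ultimately show ?thesis by blast
qed

end
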